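(* Let $\eta\in\mathbb{R}$, $\lambda>-1/2$, $\beta>-1/2$, let $\tau>0$ be a constant, and let $$w(\theta)=\tau\,e^{-\eta\theta}\,[\sin^2(\theta/2)]^{\lambda}\,[\cos^2(\theta/2)]^{\beta},\qquad 0\le\theta\le2\pi.$$ Then $w$ is a semi-classical weight function on the unit circle: it satisfies the Pearson-type equation $$\frac{d}{d\theta}\big[A(e^{i\theta})w(\theta)\big]=B(e^{i\theta})w(\theta)$$ with $$A(z)=z^2-1,\qquad B(z)=i\big[(\lambda+\beta+i\eta+2)z^2+2(\lambda-\beta)z+\lambda+\beta-i\eta\big].$$ Consequently $w$ belongs to the class $(2,2)$.
   Context: A weight function $w$ on the unit circle (written as a function of $\theta\in[0,2\pi]$) is called semi-classical if $\frac{d}{d\theta}[A(e^{i\theta})w(\theta)]=B(e^{i\theta})w(\theta)$ for some Laurent polynomials $A,B$, where $A(e^{i\theta})=0$ at the singular points of $1/w$. The equation is understood at all $\theta\in(0,2\pi)$ with $A(e^{i\theta})\ne0$. If $A,B$ are polynomials with $\deg A=p$ and $\max\{p-1,\deg((p-1)A(z)+iB(z))\}=q$, then $w$ is said to belong to the class $(p,q)$. *)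

theory Defs
  imports "HOL-Complex_Analysis.Complex_Analysis"
begin

text \<open>
  A function on the unit circle is a real function of the angle, of which only the values on
  \<open>{0..2 * pi}\<close> matter; the angle \<open>t\<close> stands for the point \<open>cis t\<close>.
\<close>

definition weight_function :: "(real \<Rightarrow> real) \<Rightarrow> bool" where
  "weight_function w \<longleftrightarrow>
     (\<forall>t\<in>{0..2 * pi}. 0 \<le> w t) \<and>
     set_integrable lborel {0..2 * pi} w \<and>
     0 < set_lebesgue_integral lborel {0..2 * pi} w"

definition laurent_polynomial :: "(complex \<Rightarrow> complex) \<Rightarrow> bool" where
  "laurent_polynomial A \<longleftrightarrow>
     (\<exists>(n::nat) (c :: int \<Rightarrow> complex). \<forall>z. z \<noteq> 0 \<longrightarrow> A z = (\<Sum>k = - int n..int n. c k * z powi k))"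

text \<open>
  Real-analyticity near the point \<open>z\<close> of the circle, expressed by a holomorphic extension to a
  neighbourhood of \<open>z\<close>. The arcs next to the angles \<open>0\<close> and \<open>2 * pi\<close> meet at \<open>z = 1\<close>, so a jump
  between the two ends of the interval counts as a singularity at \<open>1\<close>.
\<close>

definition circle_analytic_at :: "(real \<Rightarrow> real) \<Rightarrow> complex \<Rightarrow> bool" where
  "circle_analytic_at f z \<longleftrightarrow>
     (\<exists>F. F analytic_on {z} \<and>
        (\<exists>r>0. \<forall>t\<in>{0..2 * pi}. dist (cis t) z < r \<longrightarrow> F (cis t) = complex_of_real (f t)))"

text \<open>
  The first disjunct is needed because \<open>1 / 0 = 0\<close> in HOL: a zero of \<open>w\<close> is a point where \<open>1 / w\<close>
  is undefined.
\<close>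

definition singular_point_of_reciprocal :: "(real \<Rightarrow> real) \<Rightarrow> complex \<Rightarrow> bool" where
  "singular_point_of_reciprocal w z \<longleftrightarrow>
     (\<exists>t\<in>{0..2 * pi}. cis t = z \<and> w t = 0) \<or> \<not> circle_analytic_at (\<lambda>t. 1 / w t) z"

definition pearson_equation ::
    "(real \<Rightarrow> real) \<Rightarrow> (complex \<Rightarrow> complex) \<Rightarrow> (complex \<Rightarrow> complex) \<Rightarrow> bool" where
  "pearson_equation w A B \<longleftrightarrow>
     (\<forall>t\<in>{0<..<2 * pi}. A (cis t) \<noteq> 0 \<longrightarrow>
        ((\<lambda>s. A (cis s) * complex_of_real (w s)) has_vector_derivative
           B (cis t) * complex_of_real (w t)) (at t))"

text \<open>
  The coefficient \<open>A\<close> is required not to vanish identically; otherwise \<open>A = B = 0\<close> would make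
  every weight function semi-classical.
\<close>

definition semi_classical_with ::
    "(real \<Rightarrow> real) \<Rightarrow> (complex \<Rightarrow> complex) \<Rightarrow> (complex \<Rightarrow> complex) \<Rightarrow> bool" where
  "semi_classical_with w A B \<longleftrightarrow>
     weight_function w \<and>
     laurent_polynomial A \<and> laurent_polynomial B \<and> (\<exists>z. z \<noteq> 0 \<and> A z \<noteq> 0) \<and>
     (\<forall>t\<in>{0..2 * pi}. singular_point_of_reciprocal w (cis t) \<longrightarrow> A (cis t) = 0) \<and>
     pearson_equation w A B"

definition semi_classical :: "(real \<Rightarrow> real) \<Rightarrow> bool" where
  "semi_classical w \<longleftrightarrow> (\<exists>A B. semi_classical_with w A B)"

text \<open>
  For \<open>p = 0\<close> the truncated \<open>p - 1\<close> in the maximum is harmless, since \<open>degree\<close> is nonnegative.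
\<close>

definition of_class_with ::
    "(real \<Rightarrow> real) \<Rightarrow> complex poly \<Rightarrow> complex poly \<Rightarrow> nat \<Rightarrow> nat \<Rightarrow> bool" where
  "of_class_with w A B p q \<longleftrightarrow>
     semi_classical_with w (poly A) (poly B) \<and>
     degree A = p \<and>
     max (p - 1) (degree (smult (of_nat p - 1) A + smult \<i> B)) = q"

definition of_class :: "(real \<Rightarrow> real) \<Rightarrow> nat \<Rightarrow> nat \<Rightarrow> bool" where
  "of_class w p q \<longleftrightarrow> (\<exists>A B. of_class_with w A B p q)"

text \<open>
  Real power of a base \<open>x \<ge> 0\<close> with \<open>x\<^sup>0 = 1\<close> also at \<open>x = 0\<close>, where \<open>powr\<close> gives \<open>0\<close>. For
  \<open>x = 0\<close> and \<open>a < 0\<close> the value \<open>0\<close> stands in for the infinite one.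
\<close>

definition real_power :: "real \<Rightarrow> real \<Rightarrow> real" where
  "real_power x a = (if a = 0 then 1 else x powr a)"

end

theory Submission imports Defs begin

text \<open>
  On the circle \<open>z\<^sup>2 - 1 = 2 * \<i> * sin t * z\<close> for \<open>z = cis t\<close>, so \<open>A\<close> vanishes exactly at the angles
  \<open>0\<close>, \<open>pi\<close>, \<open>2 * pi\<close>, where one of the factors \<open>sin\<^sup>2 (t / 2)\<close>, \<open>cos\<^sup>2 (t / 2)\<close> vanishes. At every
  other angle both factors are positive, so the weight is \<open>\<tau>\<close> times the exponential of
  \<open>- \<eta> * t + lam * ln (sin\<^sup>2 (t / 2)) + \<beta> * ln (cos\<^sup>2 (t / 2))\<close>
  (\<open>jacobi_circle_weight_eq_exp\<close>). Most of the theorem is read off from this formula.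

  The logarithmic derivative of the weight is \<open>q = - \<eta> + lam * cot (t / 2) - \<beta> * tan (t / 2)\<close>. Its poles
  are simple and lie at zeros of \<open>sin\<close>: the product \<open>q * sin t\<close> is a trigonometric polynomial of
  degree one, and therefore \<open>(z\<^sup>2 - 1) * q\<close> is a quadratic polynomial in \<open>z\<close>. Adding the derivative
  \<open>2 * \<i> * z\<^sup>2\<close> of \<open>A\<close> along the circle gives \<open>B\<close>
  (\<open>pearson_equation_jacobi_circle_weight\<close>).

  Away from the zeros of \<open>A\<close> the reciprocal of the weight extends holomorphically: on the plane
  slit along the positive reals the angle is \<open>pi - \<i> * Ln (- z)\<close>, and the squared half-angle
  functions are Laurent polynomials in \<open>z\<close> with positive values on the circle off \<open>1\<close> and \<open>- 1\<close>,
  so their logarithms are holomorphic nearby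
  (\<open>circle_analytic_at_reciprocal_jacobi_circle_weight\<close>).

  Integrability uses \<open>sin\<^sup>2 (t / 2) * cos\<^sup>2 (t / 2) = (sin t / 2)\<^sup>2\<close>: lowering both exponents to
  \<open>a = min lam \<beta> 0\<close> bounds the weight by a multiple of \<open>\<bar>sin t\<bar> powr (2 * a)\<close>, and \<open>2 * a > - 1\<close>
  makes this integrable, since \<open>\<bar>sin t\<bar>\<close> is at least \<open>2 / pi\<close> times the distance to the nearest zero.

  Finally, \<open>A + \<i> * B\<close> has leading coefficient \<open>- (lam + \<beta> + 1) - \<i> * \<eta>\<close>, whose real part is
  negative because \<open>lam + \<beta> > - 1\<close>. Hence the
  second index of the class is \<open>2\<close> for every \<open>\<eta>\<close>.
\<close>

section \<open>Integrability of negative powers of the sine\<close>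

text \<open>
  Jordan's inequality: the sine is concave on \<open>{0..pi / 2}\<close>, and \<open>2 / pi * x\<close> is its chord there.
\<close>

lemma jordan_sin_lower_bound:
  fixes x :: real
  assumes "0 \<le> x" "x \<le> pi / 2"
  shows "2 / pi * x \<le> sin x"
proof -
  have "concave_on {0..pi/2} (sin :: real \<Rightarrow> real)"
  proof (rule f''_le0_imp_concave)
    show "convex {0..pi/2}" by simp
    show "(sin has_real_derivative cos y) (at y)" for y :: real
      by (auto intro!: derivative_eq_intros)
    show "(cos has_real_derivative - sin y) (at y)" for y :: real
      by (auto intro!: derivative_eq_intros)
    show "- sin y \<le> 0" if "y \<in> {0..pi/2}" for y :: real
      using that by (auto intro!: sin_ge_zero)
  qed
  from concave_onD[OF this, of "2 / pi * x" 0 "pi / 2"] assms show ?thesis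
    by (simp add: field_simps)
qed

lemma abs_sin_lower_bound:
  fixes x :: real
  assumes "x \<in> {0..2 * pi}"
  obtains c where "c \<in> {0, pi, 2 * pi}" "2 / pi * \<bar>x - c\<bar> \<le> \<bar>sin x\<bar>"
proof -
  consider "x \<in> {0..pi/2}" | "x \<in> {pi/2..pi}" | "x \<in> {pi..3*pi/2}" | "x \<in> {3*pi/2..2*pi}"
    using assms by fastforce
  then show thesis
  proof cases
    case 1
    then show thesis using jordan_sin_lower_bound[of x] by (intro that[of 0]) auto
  next
    case 2
    then show thesis using jordan_sin_lower_bound[of "pi - x"] by (intro that[of pi]) auto
  next
    case 3
    then show thesis using jordan_sin_lower_bound[of "x - pi"] by (intro that[of pi]) auto
  next
    case 4
    then show thesis using jordan_sin_lower_bound[of "2 * pi - x"]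
      by (intro that[of "2 * pi"]) (auto simp: sin_diff)
  qed
qed

lemma integrable_on_abs_diff_powr:
  fixes b c l u :: real
  assumes "b > -1"
  shows "(\<lambda>x. \<bar>x - c\<bar> powr b) integrable_on {l..u}"
proof -
  define R where "R = \<bar>l - c\<bar> + \<bar>u - c\<bar>"
  have "R \<ge> 0" by (simp add: R_def)
  have 1: "(\<lambda>x. \<bar>x\<bar> powr b) integrable_on {0..R}"
    using integrable_on_powr_from_0[OF assms \<open>R \<ge> 0\<close>] by (rule integrable_eq) auto
  have 2: "(\<lambda>x. \<bar>x\<bar> powr b) integrable_on {-R..0}"
    using 1 Henstock_Kurzweil_Integration.integrable_reflect_real[where f = "\<lambda>x. \<bar>x\<bar> powr b" and a = 0 and b = R]
    by (simp only: abs_minus_cancel minus_zero)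
  have "(\<lambda>x. \<bar>x\<bar> powr b) integrable_on {-R..R}"
    using Henstock_Kurzweil_Integration.integrable_combine[OF _ _ 2 1] \<open>R \<ge> 0\<close> by simp
  then have "(\<lambda>x. \<bar>x - c\<bar> powr b) integrable_on {-R + c..R + c}"
    using integrable_on_shift_Icc_real[of "\<lambda>x. \<bar>x - c\<bar> powr b" c "-R" R] by (simp add: o_def)
  then show ?thesis
    by (rule integrable_subinterval_real) (auto simp: R_def)
qed

lemma set_integrable_abs_diff_powr:
  fixes b c l u :: real
  assumes "b > -1"
  shows "set_integrable lborel {l..u} (\<lambda>x. \<bar>x - c\<bar> powr b)"
proof -
  have "(\<lambda>x. \<bar>x - c\<bar> powr b) absolutely_integrable_on {l..u}"
    using integrable_on_abs_diff_powr[OF assms] by (rule nonnegative_absolutely_integrable_1) auto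
  then show ?thesis
    unfolding set_integrable_def by (subst (asm) integrable_completion) auto
qed

text \<open>
  The sum over the three zeros avoids splitting the interval: for a nonpositive exponent the
  summand of the nearest zero, times \<open>(2 / pi) powr b\<close>, already dominates, and the others are
  nonnegative.
\<close>

lemma set_integrable_abs_sin_powr:
  fixes b :: real
  assumes "-1 < b" "b \<le> 0"
  shows "set_integrable lborel {0..2 * pi} (\<lambda>x. \<bar>sin x\<bar> powr b)"
proof -
  define C where "C = (2 / pi) powr b"
  have "set_integrable lborel {0..2 * pi}
      (\<lambda>x. C * (\<bar>x - 0\<bar> powr b + \<bar>x - pi\<bar> powr b + \<bar>x - 2 * pi\<bar> powr b))"
    by (intro set_integrable_mult_right set_integral_add set_integrable_abs_diff_powr assms)
  then show ?thesis
  proof (rule set_integrable_bound)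
    show "set_borel_measurable lborel {0..2 * pi} (\<lambda>x. \<bar>sin x\<bar> powr b)"
      unfolding set_borel_measurable_def by measurable
    have "\<bar>sin x\<bar> powr b \<le> C * (\<bar>x - 0\<bar> powr b + \<bar>x - pi\<bar> powr b + \<bar>x - 2 * pi\<bar> powr b)"
      if x: "x \<in> {0..2 * pi}" for x
    proof (cases "sin x = 0")
      case False
      obtain c where c: "c \<in> {0, pi, 2 * pi}" "2 / pi * \<bar>x - c\<bar> \<le> \<bar>sin x\<bar>"
        by (rule abs_sin_lower_bound[OF x])
      have "x \<noteq> c" using False c(1) by auto
      have "\<bar>sin x\<bar> powr b \<le> (2 / pi * \<bar>x - c\<bar>) powr b"
        using c(2) \<open>x \<noteq> c\<close> assms by (intro powr_mono2') auto
      also have "\<dots> = C * \<bar>x - c\<bar> powr b"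
        unfolding C_def by (rule powr_mult)
      also have "\<dots> \<le> C * (\<bar>x - 0\<bar> powr b + \<bar>x - pi\<bar> powr b + \<bar>x - 2 * pi\<bar> powr b)"
        using c(1) by (intro mult_left_mono) (auto simp: C_def)
      finally show ?thesis .
    qed (simp add: C_def)
    then show "AE x in lborel. x \<in> {0..2 * pi} \<longrightarrow> norm (\<bar>sin x\<bar> powr b)
        \<le> norm (C * (\<bar>x - 0\<bar> powr b + \<bar>x - pi\<bar> powr b + \<bar>x - 2 * pi\<bar> powr b))"
      by (auto intro!: AE_I2 order_trans[OF _ abs_ge_self])
  qed
qed

section \<open>The weight and its total mass\<close>

definition jacobi_circle_weight :: "real \<Rightarrow> real \<Rightarrow> real \<Rightarrow> real \<Rightarrow> real \<Rightarrow> real" where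
  "jacobi_circle_weight \<eta> lam \<beta> \<tau> \<theta> =
     \<tau> * exp (- \<eta> * \<theta>) * real_power ((sin (\<theta> / 2))\<^sup>2) lam * real_power ((cos (\<theta> / 2))\<^sup>2) \<beta>"

lemma real_power_pos: "x > 0 \<Longrightarrow> real_power x a = x powr a"
  by (simp add: real_power_def)

lemma borel_measurable_real_power [measurable]:
  "f \<in> borel_measurable M \<Longrightarrow> (\<lambda>x. real_power (f x) a) \<in> borel_measurable M"
  unfolding real_power_def by (cases "a = 0") auto

lemma half_angle_squares_pos:
  fixes t :: real
  assumes "sin t \<noteq> 0"
  shows "0 < (sin (t / 2))\<^sup>2" "0 < (cos (t / 2))\<^sup>2"
proof -
  have "sin t = 2 * sin (t / 2) * cos (t / 2)"
    using sin_double[of "t / 2"] by simp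
  with assms show "0 < (sin (t / 2))\<^sup>2" "0 < (cos (t / 2))\<^sup>2"
    by auto
qed

lemma jacobi_circle_weight_eq_exp:
  assumes "sin t \<noteq> 0"
  shows "jacobi_circle_weight \<eta> lam \<beta> \<tau> t =
    \<tau> * exp (- \<eta> * t + lam * ln ((sin (t / 2))\<^sup>2) + \<beta> * ln ((cos (t / 2))\<^sup>2))"
proof -
  note pos = half_angle_squares_pos[OF assms]
  have "(sin (t / 2))\<^sup>2 powr lam = exp (lam * ln ((sin (t / 2))\<^sup>2))"
    "(cos (t / 2))\<^sup>2 powr \<beta> = exp (\<beta> * ln ((cos (t / 2))\<^sup>2))"
    using pos unfolding powr_def by auto
  then show ?thesis
    unfolding jacobi_circle_weight_def real_power_pos[OF pos(1)] real_power_pos[OF pos(2)]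
    by (simp only: exp_add mult.assoc)
qed

lemma AE_sin_nonzero_on_circle: "AE x in lborel. x \<in> {0..2 * pi} \<longrightarrow> sin (x::real) \<noteq> 0"
proof -
  have zeros: "x \<in> {0, pi, 2 * pi}" if x: "x \<in> {0..2 * pi}" "sin x = 0" for x :: real
    using abs_sin_lower_bound[OF x(1)] x(2)
    by (smt (verit) divide_pos_pos mult_pos_pos pi_gt_zero)
  have "AE x in lborel. x \<notin> {0, pi, 2 * pi :: real}"
    by (intro AE_not_in finite_imp_null_set_lborel) auto
  then show ?thesis by eventually_elim (use zeros in blast)
qed

text \<open>
  Both squares lie in \<open>{0<..1}\<close> almost everywhere, so replacing each exponent by a common smaller one
  only enlarges the weight; then the product of the two powers is a power of the sine alone.
\<close>

lemma set_integrable_jacobi_circle_weight: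
  assumes "lam > - 1 / 2" "\<beta> > - 1 / 2" "\<tau> > 0"
  shows "set_integrable lborel {0..2 * pi} (jacobi_circle_weight \<eta> lam \<beta> \<tau>)"
proof -
  define a where "a = min (min lam \<beta>) 0"
  define C where "C = \<tau> * exp (\<bar>\<eta>\<bar> * (2 * pi)) * (1 / 2) powr (2 * a)"
  have a: "a \<le> lam" "a \<le> \<beta>" "a \<le> 0" "-1 < 2 * a" using assms by (auto simp: a_def)
  have "set_integrable lborel {0..2 * pi} (\<lambda>x. C * \<bar>sin x\<bar> powr (2 * a))"
    using a by (intro set_integrable_mult_right set_integrable_abs_sin_powr) auto
  then show ?thesis
  proof (rule set_integrable_bound)
    show "set_borel_measurable lborel {0..2 * pi} (jacobi_circle_weight \<eta> lam \<beta> \<tau>)"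
      unfolding set_borel_measurable_def jacobi_circle_weight_def by measurable
    have "norm (jacobi_circle_weight \<eta> lam \<beta> \<tau> x) \<le> norm (C * \<bar>sin x\<bar> powr (2 * a))"
      if x: "x \<in> {0..2 * pi}" "sin x \<noteq> 0" for x
    proof -
      let ?s = "(sin (x / 2))\<^sup>2" and ?c = "(cos (x / 2))\<^sup>2"
      note pos = half_angle_squares_pos[OF x(2)]
      have le1: "?s \<le> 1" "?c \<le> 1" by (auto simp: abs_square_le_1)
      have "jacobi_circle_weight \<eta> lam \<beta> \<tau> x = (\<tau> * exp (- \<eta> * x)) * (?s powr lam * ?c powr \<beta>)"
        using pos by (simp only: jacobi_circle_weight_def real_power_pos mult.assoc)
      also have "\<dots> \<le> (\<tau> * exp (\<bar>\<eta>\<bar> * (2 * pi))) * (?s powr a * ?c powr a)"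
      proof (intro mult_mono)
        have "- \<eta> * x \<le> \<bar>\<eta>\<bar> * x" using x by (intro mult_right_mono) auto
        also have "\<dots> \<le> \<bar>\<eta>\<bar> * (2 * pi)" using x by (intro mult_left_mono) auto
        finally show "exp (- \<eta> * x) \<le> exp (\<bar>\<eta>\<bar> * (2 * pi))" by simp
        show "?s powr lam \<le> ?s powr a" "?c powr \<beta> \<le> ?c powr a"
          using a pos le1 by (auto intro!: powr_mono')
      qed (use assms in auto)
      also have "?s powr a * ?c powr a = (?s * ?c) powr a"
        by (simp add: powr_mult)
      also have "?s * ?c = (1 / 2 * \<bar>sin x\<bar>)\<^sup>2"
        using sin_double[of "x / 2"] by (simp add: power_mult_distrib power_divide)
      also have "\<dots> powr a = (1 / 2 * \<bar>sin x\<bar>) powr (2 * a)"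
        using x by (simp flip: powr_numeral add: powr_powr)
      also have "\<dots> = (1 / 2) powr (2 * a) * \<bar>sin x\<bar> powr (2 * a)"
        by (simp only: powr_mult)
      finally have "jacobi_circle_weight \<eta> lam \<beta> \<tau> x \<le> C * \<bar>sin x\<bar> powr (2 * a)"
        by (simp add: C_def mult.assoc)
      moreover have "0 \<le> jacobi_circle_weight \<eta> lam \<beta> \<tau> x"
        using assms by (simp add: jacobi_circle_weight_eq_exp[OF x(2)])
      ultimately show ?thesis by simp
    qed
    with AE_sin_nonzero_on_circle show "AE x in lborel. x \<in> {0..2 * pi} \<longrightarrow>
        norm (jacobi_circle_weight \<eta> lam \<beta> \<tau> x) \<le> norm (C * \<bar>sin x\<bar> powr (2 * a))"
      by (auto elim!: eventually_mono)
  qed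
qed

lemma weight_function_jacobi_circle_weight:
  assumes "lam > - 1 / 2" "\<beta> > - 1 / 2" "\<tau> > 0"
  shows "weight_function (jacobi_circle_weight \<eta> lam \<beta> \<tau>)"
proof -
  let ?w = "jacobi_circle_weight \<eta> lam \<beta> \<tau>"
  have nonneg: "0 \<le> ?w t" for t
    using assms by (simp add: jacobi_circle_weight_def real_power_def)
  note int = set_integrable_jacobi_circle_weight[OF assms, of \<eta>]
  have "set_lebesgue_integral lborel {0..2 * pi} ?w \<noteq> 0"
  proof
    assume "set_lebesgue_integral lborel {0..2 * pi} ?w = 0"
    then have "AE x in lborel. indicator {0..2 * pi} x *\<^sub>R ?w x = 0"
      using integral_nonneg_eq_0_iff_AE[OF int[unfolded set_integrable_def]] nonneg
      by (auto simp: set_lebesgue_integral_def)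
    with AE_sin_nonzero_on_circle have "AE x in lborel. x \<notin> {0..2 * pi :: real}"
      by eventually_elim (use assms in \<open>auto simp: jacobi_circle_weight_eq_exp\<close>)
    then have "{0..2 * pi :: real} \<in> null_sets lborel"
      by (subst (asm) AE_iff_null_sets[symmetric]) auto
    then show False
      by (simp add: null_sets_def)
  qed
  moreover have "0 \<le> set_lebesgue_integral lborel {0..2 * pi} ?w"
    unfolding set_lebesgue_integral_def using nonneg by (intro Bochner_Integration.integral_nonneg) auto
  ultimately show ?thesis
    using nonneg int by (auto simp: weight_function_def)
qed

section \<open>Zeros of the coefficient and singular points\<close>

lemma cis_square_minus_one: "(cis t)\<^sup>2 - 1 = 2 * \<i> * of_real (sin t) * cis t"
proof -
  have "cos t * cos t = 1 - sin t * sin t" using sin_cos_squared_add3[of t] by linarith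
  then show ?thesis by (simp add: complex_eq_iff power2_eq_square)
qed

lemma poly_square_minus_one_cis_eq_0_iff: "poly [:- 1, 0, 1:] (cis t) = 0 \<longleftrightarrow> sin t = 0"
proof -
  have "poly [:- 1, 0, 1:] (cis t) = (cis t)\<^sup>2 - 1"
    by (simp add: power2_eq_square)
  then show ?thesis by (simp add: cis_square_minus_one)
qed

text \<open>
  The extension is the exponential formula for the reciprocal with the angle and the two squares
  written in terms of \<open>z\<close>. It agrees with the reciprocal at the points of the circle within
  \<open>\<bar>sin t\<bar>\<close> of \<open>cis t\<close>: those are not real, so their angle is not an endpoint and the branch of the
  logarithm is the right one.
\<close>

lemma circle_analytic_at_reciprocal_jacobi_circle_weight:
  assumes "t \<in> {0..2 * pi}" "sin t \<noteq> 0" "\<tau> > 0"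
  shows "circle_analytic_at (\<lambda>s. 1 / jacobi_circle_weight \<eta> lam \<beta> \<tau> s) (cis t)"
proof -
  define F where "F = (\<lambda>z. exp (of_real \<eta> * (of_real pi - \<i> * Ln (- z))
      - of_real lam * Ln ((2 - z - 1 / z) / 4) - of_real \<beta> * Ln ((2 + z + 1 / z) / 4))
      / of_real \<tau>)"
  have inv: "1 / cis s = cis (- s)" for s
    by (simp add: divide_inverse)
  have sq: "(2 - cis s - 1 / cis s) / 4 = of_real ((sin (s / 2))\<^sup>2)"
    "(2 + cis s + 1 / cis s) / 4 = of_real ((cos (s / 2))\<^sup>2)" for s
    unfolding inv using cos_double_sin[of "s / 2"] cos_double_cos[of "s / 2"]
    by (simp_all add: complex_eq_iff Re_divide_numeral Im_divide_numeral)
  have F_cis: "F (cis s) = complex_of_real (1 / jacobi_circle_weight \<eta> lam \<beta> \<tau> s)"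
    if "s \<in> {0..2 * pi}" "sin s \<noteq> 0" for s
  proof -
    have "s \<noteq> 0" "s \<noteq> 2 * pi" using that by auto
    then have s: "0 < s" "s < 2 * pi" using that by auto
    have ln: "Ln (- cis s) = \<i> * of_real (s - pi)"
    proof (rule Ln_unique)
      have "exp (\<i> * of_real (s - pi)) = cis (s - pi)" by (simp only: cis_conv_exp)
      also have "\<dots> = - cis s" by (simp add: complex_eq_iff)
      finally show "exp (\<i> * of_real (s - pi)) = - cis s" .
    qed (use s in auto)
    define L where "L = \<eta> * s - lam * ln ((sin (s / 2))\<^sup>2) - \<beta> * ln ((cos (s / 2))\<^sup>2)"
    note pos = half_angle_squares_pos[OF that(2)]
    have "F (cis s) = exp (of_real L) / of_real \<tau>"
      unfolding F_def sq ln L_def Ln_of_real[OF pos(1)] Ln_of_real[OF pos(2)]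
      by (simp add: algebra_simps)
    also have "\<dots> = of_real (exp L / \<tau>)"
      by (simp add: exp_of_real)
    also have "jacobi_circle_weight \<eta> lam \<beta> \<tau> s = \<tau> * exp (- L)"
      by (simp add: jacobi_circle_weight_eq_exp[OF that(2)] L_def algebra_simps)
    then have "exp L / \<tau> = 1 / jacobi_circle_weight \<eta> lam \<beta> \<tau> s"
      by (simp add: exp_minus inverse_eq_divide)
    finally show ?thesis .
  qed
  have "- cis t \<notin> \<real>\<^sub>\<le>\<^sub>0"
    using assms(2) by (simp add: complex_nonpos_Reals_iff)
  moreover have "(2 - cis t - 1 / cis t) / 4 \<notin> \<real>\<^sub>\<le>\<^sub>0" "(2 + cis t + 1 / cis t) / 4 \<notin> \<real>\<^sub>\<le>\<^sub>0"
    using half_angle_squares_pos[OF assms(2)]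
    by (simp_all only: sq complex_nonpos_Reals_iff Re_complex_of_real Im_complex_of_real) auto
  ultimately have "F analytic_on {cis t}"
    unfolding F_def using assms(3) by (intro analytic_intros) auto
  moreover have "F (cis s) = complex_of_real (1 / jacobi_circle_weight \<eta> lam \<beta> \<tau> s)"
    if "s \<in> {0..2 * pi}" "dist (cis s) (cis t) < \<bar>sin t\<bar>" for s
  proof (rule F_cis[OF that(1)])
    have "\<bar>sin s - sin t\<bar> \<le> dist (cis s) (cis t)"
      using abs_Im_le_cmod[of "cis s - cis t"] by (simp add: dist_norm)
    with that(2) show "sin s \<noteq> 0" by auto
  qed
  ultimately show ?thesis
    unfolding circle_analytic_at_def using assms(2) by (intro exI[of _ F] conjI exI[of _ "\<bar>sin t\<bar>"]) auto
qed

section \<open>The Pearson equation\<close>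

text \<open>
  With \<open>z = cis t\<close>, the identities \<open>z\<^sup>2 - 1 = 2 * \<i> * sin t * z\<close> and \<open>z\<^sup>2 + 1 = 2 * cos t * z\<close> turn the
  trigonometric polynomial \<open>q * sin t\<close> into a polynomial in \<open>z\<close>.
\<close>

lemma pearson_equation_jacobi_circle_weight:
  "pearson_equation (jacobi_circle_weight \<eta> lam \<beta> \<tau>) (poly [:- 1, 0, 1:])
     (poly (smult \<i> [:of_real lam + of_real \<beta> - \<i> * of_real \<eta>,
                      2 * (of_real lam - of_real \<beta>),
                      of_real lam + of_real \<beta> + \<i> * of_real \<eta> + 2:]))"
  (is "pearson_equation ?w (poly ?A) (poly ?B)")
  unfolding pearson_equation_def
proof (intro ballI impI)
  fix t assume "t \<in> {0<..<2 * pi}" "poly ?A (cis t) \<noteq> 0"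
  then have sin: "sin t \<noteq> 0" unfolding poly_square_minus_one_cis_eq_0_iff by simp
  define g where "g = (\<lambda>s. \<tau> * exp (- \<eta> * s + lam * ln ((sin (s / 2))\<^sup>2) + \<beta> * ln ((cos (s / 2))\<^sup>2)))"
  define q where "q = - \<eta> + lam * (cos (t / 2) / sin (t / 2)) - \<beta> * (sin (t / 2) / cos (t / 2))"
  have nz: "sin (t / 2) \<noteq> 0" "cos (t / 2) \<noteq> 0"
    using half_angle_squares_pos[OF sin] by auto
  have "(g has_real_derivative q * g t) (at t)"
    unfolding g_def q_def using nz
    by (auto intro!: derivative_eq_intros) (simp add: field_simps power2_eq_square)
  then have "((\<lambda>s. complex_of_real (g s)) has_vector_derivative of_real (q * g t)) (at t)"
    by (intro has_vector_derivative_of_real) (simp add: has_real_derivative_iff_has_vector_derivative)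
  moreover have "(cis has_vector_derivative \<i> * cis t) (at t)"
    using has_derivative_cis[OF has_derivative_ident]
    by (simp add: has_vector_derivative_def)
  moreover from calculation(2) calculation(2)
  have "((\<lambda>s. cis s * cis s - 1) has_vector_derivative (cis t * (\<i> * cis t) + \<i> * cis t * cis t - 0)) (at t)"
    by (intro has_vector_derivative_diff has_vector_derivative_mult has_vector_derivative_const)
  then have "((\<lambda>s. poly ?A (cis s)) has_vector_derivative 2 * \<i> * (cis t)\<^sup>2) (at t)"
    by (simp add: power2_eq_square algebra_simps)
  ultimately have "((\<lambda>s. poly ?A (cis s) * of_real (g s)) has_vector_derivative
      (poly ?A (cis t) * of_real (q * g t) + 2 * \<i> * (cis t)\<^sup>2 * of_real (g t))) (at t)"
    by (intro has_vector_derivative_mult)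
  also have "poly ?A (cis t) * of_real (q * g t) + 2 * \<i> * (cis t)\<^sup>2 * of_real (g t) =
      poly ?B (cis t) * of_real (g t)"
  proof -
    have q: "q * sin t = - \<eta> * sin t + lam * (1 + cos t) - \<beta> * (1 - cos t)"
    proof -
      have half: "sin t = 2 * sin (t / 2) * cos (t / 2)" "1 + cos t = 2 * (cos (t / 2))\<^sup>2"
        "1 - cos t = 2 * (sin (t / 2))\<^sup>2"
        using sin_double[of "t / 2"] cos_double_sin[of "t / 2"] cos_double_cos[of "t / 2"] by auto
      show ?thesis
        unfolding q_def half using nz by (simp add: field_simps power2_eq_square)
    qed
    define z S C Q where "z = cis t" and "S = complex_of_real (sin t)"
      and "C = complex_of_real (cos t)" and "Q = complex_of_real q"
    have A: "z\<^sup>2 - 1 = 2 * \<i> * S * z"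
      unfolding z_def S_def by (rule cis_square_minus_one)
    have C: "2 * C * z = z\<^sup>2 + 1"
    proof -
      have "cos t * cos t = 1 - sin t * sin t" using sin_cos_squared_add3[of t] by linarith
      then show ?thesis by (simp add: z_def C_def complex_eq_iff power2_eq_square)
    qed
    have Q: "Q * S = - of_real \<eta> * S + of_real lam * (1 + C) - of_real \<beta> * (1 - C)"
      using arg_cong[OF q, of complex_of_real] by (simp add: Q_def S_def C_def)
    have "(z\<^sup>2 - 1) * Q + 2 * \<i> * z\<^sup>2 = 2 * \<i> * z * (Q * S) + 2 * \<i> * z\<^sup>2"
      by (simp add: A)
    also have "\<dots> = - of_real \<eta> * (2 * \<i> * S * z) + \<i> * (of_real lam * (2 * z + 2 * C * z)
        - of_real \<beta> * (2 * z - 2 * C * z)) + 2 * \<i> * z\<^sup>2"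
      by (simp add: Q algebra_simps)
    also have "\<dots> = poly ?B z"
      by (simp add: C A[symmetric]) (simp add: algebra_simps power2_eq_square)
    finally have "((z\<^sup>2 - 1) * Q + 2 * \<i> * z\<^sup>2) * of_real (g t) = poly ?B z * of_real (g t)"
      by (rule arg_cong)
    moreover have "poly ?A z = z\<^sup>2 - 1" by (simp add: power2_eq_square)
    ultimately show ?thesis
      unfolding z_def[symmetric] Q_def by (simp only: of_real_mult distrib_right mult.assoc)
  qed
  finally have deriv: "((\<lambda>s. poly ?A (cis s) * of_real (g s)) has_vector_derivative
      poly ?B (cis t) * of_real (g t)) (at t)" .
  have wg: "?w s = g s" if "sin s \<noteq> 0" for s
    using jacobi_circle_weight_eq_exp[OF that] by (simp add: g_def)
  have "open {s :: real. sin s \<noteq> 0}"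
    by (intro open_Collect_neq continuous_intros)
  from has_vector_derivative_transform_within_open[OF deriv this]
  show "((\<lambda>s. poly ?A (cis s) * of_real (?w s)) has_vector_derivative
      poly ?B (cis t) * of_real (?w t)) (at t)"
    using sin by (simp only: wg mem_Collect_eq not_False_eq_True simp_thms)
qed

section \<open>Class of the weight\<close>

lemma laurent_polynomial_poly: "laurent_polynomial (poly A)"
  unfolding laurent_polynomial_def
proof (intro exI allI impI)
  fix z :: complex
  let ?n = "degree A" and ?c = "\<lambda>k. if k < 0 then 0 else coeff A (nat k)"
  have "poly A z = (\<Sum>k\<le>?n. coeff A k * z ^ k)" by (rule poly_altdef)
  also have "\<dots> = (\<Sum>k\<in>int ` {..?n}. ?c k * z powi k)"
    by (subst sum.reindex) auto
  also have "\<dots> = (\<Sum>k = - int ?n..int ?n. ?c k * z powi k)"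
  proof (rule sum.mono_neutral_left)
    show "\<forall>k\<in>{- int ?n..int ?n} - int ` {..?n}. ?c k * z powi k = 0"
    proof
      fix k assume k: "k \<in> {- int ?n..int ?n} - int ` {..?n}"
      have "k < 0"
      proof (rule ccontr)
        assume "\<not> k < 0"
        with k have "k = int (nat k)" "nat k \<le> ?n" by auto
        then have "k \<in> int ` {..?n}" by (metis atMost_iff imageI)
        with k show False by simp
      qed
      then show "?c k * z powi k = 0" by simp
    qed
  qed auto
  finally show "poly A z = (\<Sum>k = - int ?n..int ?n. ?c k * z powi k)" .
qed

theorem mainTheorem3:
  fixes \<eta> lam \<beta> \<tau> :: real and w :: "real \<Rightarrow> real" and A B :: "complex poly"
  assumes "lam > - 1 / 2" and "\<beta> > - 1 / 2" and "\<tau> > 0"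
    and "\<And>\<theta>. \<theta> \<in> {0..2 * pi} \<Longrightarrow>
      w \<theta> = \<tau> * exp (- \<eta> * \<theta>) * real_power ((sin (\<theta> / 2))\<^sup>2) lam * real_power ((cos (\<theta> / 2))\<^sup>2) \<beta>"
    and "A = [:- 1, 0, 1:]"
    and "B = smult \<i> [:of_real lam + of_real \<beta> - \<i> * of_real \<eta>,
                      2 * (of_real lam - of_real \<beta>),
                      of_real lam + of_real \<beta> + \<i> * of_real \<eta> + 2:]"
  shows "semi_classical w \<and>
         semi_classical_with w (poly A) (poly B) \<and>
         pearson_equation w (poly A) (poly B) \<and>
         of_class_with w A B 2 2 \<and>
         of_class w 2 2"
proof -
  define v where "v = jacobi_circle_weight \<eta> lam \<beta> \<tau>"
  have wv: "w t = v t" if "t \<in> {0..2 * pi}" for t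
    using assms(4)[OF that] by (simp add: v_def jacobi_circle_weight_def)
  have weight: "weight_function w"
  proof -
    have "weight_function v"
      unfolding v_def by (rule weight_function_jacobi_circle_weight[OF assms(1-3)])
    moreover have "set_integrable lborel {0..2 * pi} w = set_integrable lborel {0..2 * pi} v"
      by (rule set_integrable_cong) (auto simp: wv)
    moreover have "set_lebesgue_integral lborel {0..2 * pi} w = set_lebesgue_integral lborel {0..2 * pi} v"
      by (rule set_lebesgue_integral_cong) (auto simp: wv)
    ultimately show ?thesis by (simp add: weight_function_def wv)
  qed
  have pearson: "pearson_equation w (poly A) (poly B)"
    unfolding pearson_equation_def
  proof (intro ballI impI)
    fix t assume t: "t \<in> {0<..<2 * pi}" "poly A (cis t) \<noteq> 0"
    have "pearson_equation v (poly A) (poly B)"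
      unfolding v_def assms(5,6) by (rule pearson_equation_jacobi_circle_weight)
    with t have "((\<lambda>s. poly A (cis s) * of_real (v s)) has_vector_derivative
        poly B (cis t) * of_real (v t)) (at t)"
      by (simp add: pearson_equation_def)
    then have "((\<lambda>s. poly A (cis s) * of_real (w s)) has_vector_derivative
        poly B (cis t) * of_real (v t)) (at t)"
      by (rule has_vector_derivative_transform_within_open[OF _ _ t(1)]) (auto simp: wv)
    with t(1) show "((\<lambda>s. poly A (cis s) * of_real (w s)) has_vector_derivative
        poly B (cis t) * of_real (w t)) (at t)"
      by (simp add: wv)
  qed
  have singular: "poly A (cis t) = 0"
    if t: "t \<in> {0..2 * pi}" "singular_point_of_reciprocal w (cis t)" for t
  proof (rule ccontr)
    assume "poly A (cis t) \<noteq> 0"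
    then have sin: "sin t \<noteq> 0" unfolding assms(5) poly_square_minus_one_cis_eq_0_iff .
    have "w s \<noteq> 0" if s: "s \<in> {0..2 * pi}" "cis s = cis t" for s
    proof -
      have "sin s \<noteq> 0" using sin s(2) by (metis cis.sel(2))
      then show ?thesis
        using assms(3) by (simp add: wv[OF s(1)] v_def jacobi_circle_weight_eq_exp)
    qed
    moreover have "circle_analytic_at (\<lambda>s. 1 / w s) (cis t)"
      using circle_analytic_at_reciprocal_jacobi_circle_weight[OF t(1) sin assms(3), of \<eta> lam \<beta>]
      by (simp add: circle_analytic_at_def wv v_def)
    ultimately show False
      using t(2) by (auto simp: singular_point_of_reciprocal_def)
  qed
  have semi: "semi_classical_with w (poly A) (poly B)"
    unfolding semi_classical_with_def
  proof (intro conjI)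
    show "\<exists>z. z \<noteq> 0 \<and> poly A z \<noteq> 0"
      by (rule exI[of _ "\<i>"]) (simp add: assms(5))
  qed (use weight pearson singular laurent_polynomial_poly in auto)
  \<comment> \<open>the coefficient of \<open>z\<^sup>2\<close> in \<open>A + \<i> * B\<close> has real part \<open>- (lam + \<beta> + 1)\<close>\<close>
  have "lam + \<beta> + 1 \<noteq> 0" using assms(1,2) by linarith
  then have "(of_nat 2 - 1) * 1 + \<i> * (\<i> * (complex_of_real lam + of_real \<beta> + \<i> * of_real \<eta> + 2)) \<noteq> 0"
    by (auto simp: complex_eq_iff)
  then have "degree (smult (of_nat 2 - 1) A + smult \<i> B) = 2"
    by (simp add: assms(5,6))
  then have "of_class_with w A B 2 2"
    using semi by (simp add: of_class_with_def assms(5))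
  with semi pearson show ?thesis
    by (auto simp: semi_classical_def of_class_def)
qed

end
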